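(* Let $\mathbf{P}=[p_{i,j}]\in\mathbb{R}^{N\times N}$ be a Markov transition matrix with column sums $\mathscr{C}_j=\sum_{\ell=1}^N p_{\ell,j}$, and assume that $\max_{j\in\{1,\dots,N\}}\mathscr{C}_j\ge N-1$. Then $$\mathscr{C}_j\le N-|\lambda_2|\qquad\text{for } j=1,2,\dots,N,$$ where $|\lambda_2|$ is the second largest absolute value of an eigenvalue of $\mathbf{P}$.
   Context: A Markov transition matrix is a matrix with nonnegative entries all of whose row sums $\sum_{\ell=1}^N p_{i,\ell}$ equal $1$. Eigenvalues are counted with multiplicity and ordered by absolute value, $|\lambda_1|\ge|\lambda_2|\ge\cdots$. *)

theory Defs
  imports
    Complex_Main
    "HOL-Library.Multiset"
    "HOL-Computational_Algebra.Polynomial"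
    "Jordan_Normal_Form.Char_Poly"
begin

definition markov_matrix :: "nat \<Rightarrow> real mat \<Rightarrow> bool" where
  "markov_matrix N P \<longleftrightarrow>
     P \<in> carrier_mat N N \<and>
     (\<forall>i<N. \<forall>j<N. P $$ (i, j) \<ge> 0) \<and>
     (\<forall>i<N. (\<Sum>l<N. P $$ (i, l)) = 1)"

definition col_sum :: "real mat \<Rightarrow> nat \<Rightarrow> real" where
  "col_sum P j = (\<Sum>l<dim_row P. P $$ (l, j))"

text \<open>The complex eigenvalues of a real matrix, with algebraic multiplicity.\<close>

definition eigvals_mset :: "real mat \<Rightarrow> complex multiset" where
  "eigvals_mset P = proots (char_poly (map_mat complex_of_real P))"

text \<open>The entry at position \<open>k\<close> is \<open>\<bar>\<lambda>\<^sub>k\<^sub>+\<^sub>1\<bar>\<close>, since list positions start at 0.\<close>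

definition abs_eigvals :: "real mat \<Rightarrow> real list" where
  "abs_eigvals P = rev (sorted_list_of_multiset (image_mset cmod (eigvals_mset P)))"

text \<open>Meaningful for matrices of size at least 2.\<close>

definition abs_lambda2 :: "real mat \<Rightarrow> real" where
  "abs_lambda2 P = abs_eigvals P ! 1"

end

theory Submission
  imports Defs
begin

text \<open>
  Fix a column \<open>m\<close>, with sum \<open>C\<^sub>m\<close>. The constant vector is an eigenvector of \<open>P\<close> for the eigenvalue \<open>1\<close>, so \<open>P\<close> acts
  on the quotient by the constants. Normalising representatives to vanish at position \<open>m\<close>, this
  action has the matrix \<open>Q\<close> with entries \<open>p\<^sub>i\<^sub>j - p\<^sub>m\<^sub>j\<close> for \<open>i, j \<noteq> m\<close>, and the characteristic
  polynomial of \<open>P\<close> is \<open>X - 1\<close> times that of \<open>Q\<close> (\<open>similar_deflate\<close>, \<open>char_poly_unit_column\<close>).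

  The absolute row sum of \<open>Q\<close> in row \<open>i\<close> is at most
  \<open>(1 - p\<^sub>i\<^sub>m) + (1 - p\<^sub>m\<^sub>m)\<close>, since the remaining entries of a row of \<open>P\<close> add up to one minus its
  entry in column \<open>m\<close>. As \<open>i \<noteq> m\<close>, these are two different terms of the sum
  \<open>\<Sum>k<N. 1 - p\<^sub>k\<^sub>m = N - C\<^sub>m\<close>, all of whose terms are nonnegative (\<open>markov_row_diff_le\<close>). Hence every
  eigenvalue of \<open>Q\<close> has absolute value at most \<open>N - C\<^sub>m\<close> (\<open>cmod_eigenvalue_le_row_sum\<close>).

  So all eigenvalues of \<open>P\<close>, except for one copy of \<open>1\<close>, are bounded by \<open>N - C\<^sub>m\<close>. At
  most one list position can then exceed that bound, and it is not the second one
  (\<open>second_largest_le\<close>).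
\<close>

section \<open>Splitting off the eigenvalue of a constant vector\<close>

text \<open>
  With \<open>a = 1\<close> this is the matrix of the basis in which the \<open>m\<close>-th unit vector is replaced by the
  constant vector, and \<open>a = - 1\<close> gives its inverse. The entries are written as a sum of two
  conditionals so that each of them collapses separately in a matrix product.
\<close>

definition add_to_column :: "nat \<Rightarrow> nat \<Rightarrow> 'a \<Rightarrow> 'a :: comm_ring_1 mat" where
  "add_to_column n m a = mat n n (\<lambda>(i, j).
     (if j = i then 1 else 0) + (if j = m then (if i = m then 0 else a) else 0))"

text \<open>
  When all row sums of \<open>A\<close> equal \<open>c\<close>, this is \<open>A\<close> in the basis just described: column \<open>m\<close> records that
  the constant vector is an eigenvector, and the entries outside row and column \<open>m\<close> describe the
  action modulo constants.
\<close>

definition deflate :: "nat \<Rightarrow> 'a \<Rightarrow> 'a mat \<Rightarrow> 'a :: comm_ring_1 mat" where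
  "deflate m c A = mat (dim_row A) (dim_col A) (\<lambda>(i, j).
     if j = m then (if i = m then c else 0)
     else A $$ (i, j) - (if i = m then 0 else A $$ (m, j)))"

lemma add_to_column_carrier [simp]: "add_to_column n m a \<in> carrier_mat n n"
  by (simp add: add_to_column_def)

lemma deflate_carrier [simp]:
  assumes A: "A \<in> carrier_mat nr nc"
  shows "deflate m c A \<in> carrier_mat nr nc"
  unfolding deflate_def carrier_matD[OF A] by (rule mat_carrier)

lemma add_to_column_mult_index:
  assumes "X \<in> carrier_mat n n" "i < n" "j < n" "m < n"
  shows "(add_to_column n m a * X) $$ (i, j)
           = X $$ (i, j) + (if i = m then 0 else a * X $$ (m, j))"
proof -
  have "(add_to_column n m a * X) $$ (i, j)
      = (\<Sum>l<n. (if l = i then X $$ (l, j) else 0)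
          + (if l = m then (if i = m then 0 else a * X $$ (l, j)) else 0))"
    using assms unfolding add_to_column_def
    by (auto simp: scalar_prod_def atLeast0LessThan intro!: sum.cong)
  then show ?thesis
    using assms by (simp add: sum.distrib)
qed

lemma add_to_column_inverse:
  assumes "m < n"
  shows "add_to_column n m a * add_to_column n m (- a) = 1\<^sub>m n"
proof (rule eq_matI)
  fix i j
  assume "i < dim_row (1\<^sub>m n :: 'a mat)" "j < dim_col (1\<^sub>m n :: 'a mat)"
  then show "(add_to_column n m a * add_to_column n m (- a)) $$ (i, j) = 1\<^sub>m n $$ (i, j)"
    using assms
    by (auto simp: add_to_column_mult_index) (auto simp: add_to_column_def)
qed (simp_all add: add_to_column_def)

text \<open>
  Both sides of \<open>A * R = R * deflate m c A\<close>, for the change of basis \<open>R\<close>, have the row sums of \<open>A\<close>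
  in column \<open>m\<close> and agree with \<open>A\<close> elsewhere.
\<close>

lemma similar_deflate:
  fixes A :: "'a :: comm_ring_1 mat"
  assumes A: "A \<in> carrier_mat n n" and m: "m < n"
    and rows: "\<And>i. i < n \<Longrightarrow> (\<Sum>l<n. A $$ (i, l)) = c"
  shows "similar_mat A (deflate m c A)"
proof -
  let ?R = "add_to_column n m (1 :: 'a)" and ?S = "add_to_column n m (- 1 :: 'a)"
  let ?B = "deflate m c A"
  have B: "?B \<in> carrier_mat n n"
    using A by simp
  have RS: "?R * ?S = 1\<^sub>m n" and SR: "?S * ?R = 1\<^sub>m n"
    using add_to_column_inverse[OF m, of 1] add_to_column_inverse[OF m, of "- 1"] by simp_all
  have "A * ?R = ?R * ?B"
  proof (rule eq_matI)
    fix i j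
    assume "i < dim_row (?R * ?B)" "j < dim_col (?R * ?B)"
    then have i: "i < n" and j: "j < n"
      using A by (auto simp: add_to_column_def deflate_def)
    have "(A * ?R) $$ (i, j)
        = (\<Sum>l<n. (if l = j then A $$ (i, l) else 0)
            + (if j = m then (if l = m then 0 else A $$ (i, l)) else 0))"
      using A m i j unfolding add_to_column_def
      by (auto simp: scalar_prod_def atLeast0LessThan intro!: sum.cong)
    also have "\<dots> = (if j = m then c else A $$ (i, j))"
    proof (cases "j = m")
      case True
      have "(\<Sum>l<n. (if l = m then A $$ (i, l) else 0)
            + (if l = m then 0 else A $$ (i, l))) = (\<Sum>l<n. A $$ (i, l))"
        by (intro sum.cong) auto
      with True show ?thesis
        using rows[OF i] by simp
    qed (use j in simp)
    also have "\<dots> = (?R * ?B) $$ (i, j)"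
      using A m i j by (simp add: add_to_column_mult_index) (auto simp: deflate_def)
    finally show "(A * ?R) $$ (i, j) = (?R * ?B) $$ (i, j)" .
  qed (use A in \<open>auto simp: add_to_column_def deflate_def\<close>)
  then have "?R * ?B * ?S = A * ?R * ?S"
    by simp
  also have "\<dots> = A"
    using A RS assoc_mult_mat[OF A, of ?R n ?S n] by simp
  finally have "A = ?R * ?B * ?S" ..
  then show ?thesis
    using A B RS SR by (intro similar_matI) auto
qed

lemma char_poly_unit_column:
  fixes A :: "'a :: idom mat"
  assumes A: "A \<in> carrier_mat n n" and m: "m < n"
    and col: "\<And>i. i < n \<Longrightarrow> A $$ (i, m) = (if i = m then c else 0)"
  shows "char_poly A = [:- c, 1:] * char_poly (mat_delete A m m)"
proof -
  let ?M = "char_poly_matrix A"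
  have M: "?M \<in> carrier_mat n n"
    using A by simp
  have "char_poly A = (\<Sum>i<n. ?M $$ (i, m) * cofactor ?M i m)"
    unfolding char_poly_def by (rule laplace_expansion_column[OF M m])
  also have "\<dots> = (\<Sum>i<n. if i = m then [:- c, 1:] * cofactor ?M m m else 0)"
    using A m col by (intro sum.cong) (auto simp: char_poly_matrix_def)
  also have "\<dots> = [:- c, 1:] * cofactor ?M m m"
    using m by simp
  also have "cofactor ?M m m = det (mat_delete ?M m m)"
    by (simp add: cofactor_def)
  also have "mat_delete ?M m m = char_poly_matrix (mat_delete A m m)"
    using A m by (auto simp: mat_delete_def char_poly_matrix_def)
  finally show ?thesis
    by (simp add: char_poly_def)
qed

section \<open>Bounding the remaining eigenvalues\<close>

text \<open>
  The bound of the spectrum by the maximum row sum norm: compare the two sides of \<open>A v = k v\<close> at a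
  position where \<open>v\<close> has its largest entry.
\<close>

lemma cmod_eigenvalue_le_row_sum:
  fixes A :: "complex mat"
  assumes A: "A \<in> carrier_mat n n" and ev: "eigenvalue A k"
    and rows: "\<And>i. i < n \<Longrightarrow> (\<Sum>j<n. cmod (A $$ (i, j))) \<le> d"
  shows "cmod k \<le> d"
proof -
  from ev obtain v where v: "v \<in> carrier_vec n" "v \<noteq> 0\<^sub>v n" "A *\<^sub>v v = k \<cdot>\<^sub>v v"
    using A unfolding eigenvalue_def eigenvector_def by auto
  then obtain i0 where i0: "i0 < n" "v $ i0 \<noteq> 0"
    by (metis carrier_vecD eq_vecI index_zero_vec)
  obtain i where i: "i < n" "\<And>j. j < n \<Longrightarrow> cmod (v $ j) \<le> cmod (v $ i)"
  proof -
    let ?S = "(\<lambda>j. cmod (v $ j)) ` {..<n}"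
    have "Max ?S \<in> ?S"
      using i0 by (intro Max_in) auto
    then obtain i where "i < n" "cmod (v $ i) = Max ?S"
      by auto
    then show thesis
      by (intro that[of i]) auto
  qed
  have pos: "0 < cmod (v $ i)"
    using i(2)[OF i0(1)] i0(2) by (meson less_le_trans zero_less_norm_iff)
  have "k * v $ i = (A *\<^sub>v v) $ i"
    using v i by simp
  also have "\<dots> = (\<Sum>j<n. A $$ (i, j) * v $ j)"
    using A v(1) i(1) by (auto simp: scalar_prod_def atLeast0LessThan intro!: sum.cong)
  finally have "cmod k * cmod (v $ i) = cmod (\<Sum>j<n. A $$ (i, j) * v $ j)"
    by (metis norm_mult)
  also have "\<dots> \<le> (\<Sum>j<n. cmod (A $$ (i, j)) * cmod (v $ i))"
    using i(2) by (intro sum_norm_le) (auto simp: norm_mult intro: mult_left_mono)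
  also have "\<dots> \<le> d * cmod (v $ i)"
    using rows[OF i(1)] by (simp flip: sum_distrib_right add: mult_right_mono)
  finally show ?thesis
    using pos by simp
qed

text \<open>
  Row sums of a minor, rewritten over the original column indices so that the shift of indices caused
  by the deletion disappears from later estimates.
\<close>

lemma sum_mat_delete_row:
  assumes A: "A \<in> carrier_mat n n" and m: "m < n" and i: "i < n - 1"
  shows "(\<Sum>j<n - 1. f (mat_delete A m m $$ (i, j)))
           = (\<Sum>j\<in>{..<n} - {m}. f (A $$ (insert_index m i, j)))"
proof -
  obtain n' where n: "n = Suc n'"
    using m by (cases n) auto
  have "(\<Sum>j\<in>{..<n} - {m}. f (A $$ (insert_index m i, j)))
      = (\<Sum>j\<in>insert_index m ` {..<n'}. f (A $$ (insert_index m i, j)))"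
    using insert_index_image[of m n'] m n by (simp add: atLeast0LessThan)
  also have "\<dots> = (\<Sum>j<n'. f (A $$ (insert_index m i, insert_index m j)))"
    by (simp add: sum.reindex[OF insert_index_inj_on])
  also have "\<dots> = (\<Sum>j<n'. f (mat_delete A m m $$ (i, j)))"
    using A m i n by (intro sum.cong) (auto simp: mat_delete_index)
  finally show ?thesis
    by (simp add: n)
qed

text \<open>
  The key estimate. By the triangle inequality the left side is at most
  \<open>(1 - p\<^sub>i\<^sub>m) + (1 - p\<^sub>m\<^sub>m)\<close>; because \<open>i \<noteq> m\<close> these are two of the \<open>N\<close> nonnegative defects
  \<open>1 - p\<^sub>k\<^sub>m\<close>, whose total is the right side.
\<close>

lemma markov_row_diff_le:
  assumes P: "markov_matrix N P" and m: "m < N" and i: "i < N" "i \<noteq> m"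
  shows "(\<Sum>j\<in>{..<N} - {m}. \<bar>P $$ (i, j) - P $$ (m, j)\<bar>) \<le> real N - col_sum P m"
proof -
  have nonneg: "\<And>i j. i < N \<Longrightarrow> j < N \<Longrightarrow> 0 \<le> P $$ (i, j)"
    and rows: "\<And>i. i < N \<Longrightarrow> (\<Sum>l<N. P $$ (i, l)) = 1" and dim: "dim_row P = N"
    using P by (auto simp: markov_matrix_def)
  have off: "(\<Sum>j\<in>{..<N} - {m}. P $$ (k, j)) = 1 - P $$ (k, m)" if "k < N" for k
    using rows[OF that] m by (simp add: sum_diff1)
  have le1: "P $$ (k, m) \<le> 1" if "k < N" for k
    using off[OF that] sum_nonneg[of "{..<N} - {m}" "\<lambda>j. P $$ (k, j)"] nonneg that by force
  have "(\<Sum>j\<in>{..<N} - {m}. \<bar>P $$ (i, j) - P $$ (m, j)\<bar>)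
      \<le> (\<Sum>j\<in>{..<N} - {m}. P $$ (i, j) + P $$ (m, j))"
    using nonneg i m by (intro sum_mono) (auto simp: abs_le_iff)
  also have "\<dots> = (\<Sum>k\<in>{i, m}. 1 - P $$ (k, m))"
    using off i m by (simp add: sum.distrib)
  also have "\<dots> \<le> (\<Sum>k<N. 1 - P $$ (k, m))"
    using le1 i m by (intro sum_mono2) auto
  also have "\<dots> = real N - col_sum P m"
    by (simp add: sum_subtractf col_sum_def dim)
  finally show ?thesis .
qed

text \<open>
  One copy of the eigenvalue \<open>1\<close> splits off as an element of the multiset, so the bound on \<open>E\<close>
  also covers further copies of \<open>1\<close> when that eigenvalue is multiple.
\<close>

lemma eigvals_mset_markov:
  assumes P: "markov_matrix N P" and m: "m < N"
  obtains E where "eigvals_mset P = add_mset 1 E" "size E = N - 1"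
    "\<And>k. k \<in># E \<Longrightarrow> cmod k \<le> real N - col_sum P m"
proof -
  let ?A = "map_mat complex_of_real P"
  let ?B = "deflate m 1 ?A"
  let ?Q = "mat_delete ?B m m"
  have dimP: "P \<in> carrier_mat N N"
    using P by (simp add: markov_matrix_def)
  then have A: "?A \<in> carrier_mat N N" and B: "?B \<in> carrier_mat N N"
    by simp_all
  have Q: "?Q \<in> carrier_mat (N - 1) (N - 1)"
    using mat_delete_carrier[OF B] .
  have rows: "(\<Sum>l<N. ?A $$ (i, l)) = 1" if "i < N" for i
  proof -
    have "(\<Sum>l<N. ?A $$ (i, l)) = complex_of_real (\<Sum>l<N. P $$ (i, l))"
      using dimP that by simp
    then show ?thesis
      using P that by (simp only: markov_matrix_def of_real_1)
  qed
  have "char_poly ?A = char_poly ?B"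
    by (rule char_poly_similar[OF similar_deflate[OF A m rows]])
  also have "\<dots> = [:- 1, 1:] * char_poly ?Q"
    using A m by (intro char_poly_unit_column[OF B]) (auto simp: deflate_def)
  finally have cp: "char_poly ?A = [:- 1, 1:] * char_poly ?Q" .
  have degQ: "degree (char_poly ?Q) = N - 1" and "coeff (char_poly ?Q) (N - 1) = 1"
    using degree_monic_char_poly[OF Q] by auto
  then have nz: "char_poly ?Q \<noteq> 0"
    by auto
  show thesis
  proof (rule that)
    show "eigvals_mset P = add_mset 1 (proots (char_poly ?Q))"
      unfolding eigvals_mset_def cp using nz by (subst proots_mult) auto
    show "size (proots (char_poly ?Q)) = N - 1"
      by (simp add: size_proots_complex degQ)
  next
    fix k
    assume "k \<in># proots (char_poly ?Q)"
    then have "eigenvalue ?Q k"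
      using nz eigenvalue_root_char_poly[OF Q] by simp
    then show "cmod k \<le> real N - col_sum P m"
    proof (rule cmod_eigenvalue_le_row_sum[OF Q])
      fix i
      assume i: "i < N - 1"
      let ?i = "insert_index m i"
      have i': "?i < N" "?i \<noteq> m"
        using i by (auto simp: insert_index_def)
      have "(\<Sum>j<N - 1. cmod (?Q $$ (i, j))) = (\<Sum>j\<in>{..<N} - {m}. cmod (?B $$ (?i, j)))"
        by (rule sum_mat_delete_row[OF B m i])
      also have "\<dots> = (\<Sum>j\<in>{..<N} - {m}. \<bar>P $$ (?i, j) - P $$ (m, j)\<bar>)"
        using dimP i' m by (intro sum.cong) (auto simp: deflate_def simp flip: of_real_diff)
      also have "\<dots> \<le> real N - col_sum P m"
        by (rule markov_row_diff_le[OF P m i'])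
      finally show "(\<Sum>j<N - 1. cmod (?Q $$ (i, j))) \<le> real N - col_sum P m" .
    qed
  qed
qed

text \<open>
  If the second entry of the decreasing list exceeded \<open>d\<close>, so would the first; but \<open>a\<close> is the only
  element of the multiset, counted with multiplicity, that can exceed \<open>d\<close>.
\<close>

lemma second_largest_le:
  fixes M :: "'a :: linorder multiset"
  assumes size: "size M \<ge> 1" and bound: "\<And>x. x \<in># M \<Longrightarrow> x \<le> d"
  shows "rev (sorted_list_of_multiset (add_mset a M)) ! 1 \<le> d"
proof (rule ccontr)
  define xs where "xs = rev (sorted_list_of_multiset (add_mset a M))"
  assume "\<not> rev (sorted_list_of_multiset (add_mset a M)) ! 1 \<le> d"
  then have gt1: "d < xs ! 1"
    by (simp add: xs_def)
  have mset: "mset xs = add_mset a M"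
    by (simp add: xs_def)
  have len: "length xs \<ge> 2"
    using size by (simp flip: size_mset add: mset)
  then obtain x y ys where xs: "xs = x # y # ys"
    by (metis One_nat_def Suc_1 Suc_le_length_iff)
  have "sorted (rev xs)"
    unfolding xs_def rev_rev_ident by (rule sorted_sorted_list_of_multiset)
  then have "y \<le> x"
    by (simp add: xs sorted_append)
  with gt1 have "d < x" "d < y"
    by (auto simp: xs)
  then have two: "size (filter_mset (\<lambda>z. d < z) (add_mset a M)) \<ge> 2"
    by (simp add: xs flip: mset)
  have none: "filter_mset (\<lambda>z. d < z) M = {#}"
    using bound by (intro multiset_eqI) (force simp: not_in_iff)
  from two show False
    by (simp add: none split: if_splits)
qed

theorem lemma3:
  fixes P :: "real mat" and N :: nat
  assumes "N \<ge> 2"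
    and "markov_matrix N P"
    and "Max (col_sum P ` {..<N}) \<ge> real N - 1"
  shows "\<forall>j<N. col_sum P j \<le> real N - abs_lambda2 P"
proof (intro allI impI)
  fix j
  assume "j < N"
  then obtain E where E: "eigvals_mset P = add_mset 1 E" "size E = N - 1"
    "\<And>k. k \<in># E \<Longrightarrow> cmod k \<le> real N - col_sum P j"
    using eigvals_mset_markov[of N P j] assms by auto
  have "abs_lambda2 P \<le> real N - col_sum P j"
    unfolding abs_lambda2_def abs_eigvals_def E(1) image_mset_add_mset
    using E(2,3) assms(1) by (intro second_largest_le) auto
  then show "col_sum P j \<le> real N - abs_lambda2 P"
    by simp
qed

end
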